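(* Let $d\ge5$ be an integer. Let $A=D_AP_A$ and $B=D_BP_B$, where $D_A=\operatorname{diag}(a_1,\dots,a_d)$ and $D_B=\operatorname{diag}(b_1,\dots,b_d)$ are complex diagonal matrices, and $P_A,P_B$ are $d\times d$ permutation matrices all of whose diagonal entries are zero. Suppose that $\sum_{i=1}^d(|a_i|^2+|b_i|^2)=\frac1d$. Let $X=A\otimes I_d+I_d\otimes B$ and let $\sigma_1\ge\sigma_2\ge\cdots\ge\sigma_{d^2}$ be the singular values of $X$. Then $\sigma_1^2+\sigma_2^2\le\frac12$.
   Context: $\otimes$ denotes the Kronecker product and $I_d$ the $d\times d$ identity matrix. Singular values are counted with multiplicity. *)

theory Defs
  imports
    "Jordan_Normal_Form.Schur_Decomposition"
    "HOL-Computational_Algebra.Fundamental_Theorem_Algebra"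
begin

definition permutation_mat :: "nat \<Rightarrow> 'a :: semiring_1 mat \<Rightarrow> bool" where
  "permutation_mat n P \<longleftrightarrow>
     (\<exists>p. p permutes {..<n} \<and> P = Matrix.mat n n (\<lambda>(i, j). if i = p j then 1 else 0))"

definition kronecker :: "'a :: semiring_1 mat \<Rightarrow> 'a mat \<Rightarrow> 'a mat" (infixl \<open>\<otimes>\<^sub>K\<close> 70) where
  "A \<otimes>\<^sub>K B = Matrix.mat (dim_row A * dim_row B) (dim_col A * dim_col B)
     (\<lambda>(i, j). A $$ (i div dim_row B, j div dim_col B) * B $$ (i mod dim_row B, j mod dim_col B))"

(* The square roots of the eigenvalues of X^* X, with algebraic multiplicity, in decreasing order
   and indexed from 0; there are dim_col X of them, so for a matrix with fewer rows than columns the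
   list is padded with zeros. The eigenvalues are complex numbers by type; Re discards nothing, as
   they are real and nonnegative (mset_singular_values_squared below). *)
definition singular_values :: "complex mat \<Rightarrow> real list" where
  "singular_values X = rev (sorted_list_of_multiset
     (image_mset (\<lambda>z. sqrt (Re z)) (proots (char_poly (mat_adjoint X * X)))))"

lemma mat_adjoint_carrier [simp]: "mat_adjoint X \<in> carrier_mat (dim_col X) (dim_row X)"
  by (auto simp: mat_adjoint_def)

lemma adjoint_mult_carrier: "mat_adjoint X * X \<in> carrier_mat (dim_col X) (dim_col X)"
  by (meson carrier_matI mat_adjoint_carrier mult_carrier_mat)

lemma mat_adjoint_index:
  "i < dim_col X \<Longrightarrow> j < dim_row X \<Longrightarrow> mat_adjoint X $$ (i, j) = conjugate (X $$ (j, i))"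
  by (simp add: mat_adjoint_def mat_of_rows_def)

lemma length_singular_values: "length (singular_values X) = dim_col X"
proof -
  have "length (singular_values X) = size (mset (singular_values X))"
    by simp
  also have "\<dots> = dim_col X"
    unfolding singular_values_def
    by (simp add: size_proots_complex degree_monic_char_poly[OF adjoint_mult_carrier]
             del: size_mset)
  finally show ?thesis .
qed

lemma singular_values_decreasing: "sorted_wrt (\<ge>) (singular_values X)"
  by (simp add: singular_values_def sorted_wrt_rev sorted_sorted_list_of_multiset)

lemma adjoint_cscalar_prod:
  fixes X :: "complex mat"
  assumes v: "v \<in> carrier_vec (dim_col X)" and w: "w \<in> carrier_vec (dim_row X)"
  shows "(mat_adjoint X *\<^sub>v w) \<bullet>c v = w \<bullet>c (X *\<^sub>v v)"
proof -
  have d: "dim_row (mat_adjoint X) = dim_col X" "dim_col (mat_adjoint X) = dim_row X"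
    using mat_adjoint_carrier[of X] by blast+
  have "(mat_adjoint X *\<^sub>v w) \<bullet>c v =
      (\<Sum>i<dim_col X. \<Sum>j<dim_row X. cnj (X $$ (j, i)) * w $ j * cnj (v $ i))"
    using v w d
    by (simp add: scalar_prod_def mat_adjoint_index sum_distrib_right atLeast0LessThan)
  also have "\<dots> = (\<Sum>j<dim_row X. \<Sum>i<dim_col X. cnj (X $$ (j, i)) * w $ j * cnj (v $ i))"
    by (rule sum.swap)
  also have "\<dots> = w \<bullet>c (X *\<^sub>v v)"
    using v w
    by (simp add: scalar_prod_def sum_distrib_left atLeast0LessThan mult_ac)
  finally show ?thesis .
qed

lemma eigenvalue_adjoint_mult:
  fixes X :: "complex mat"
  assumes "eigenvalue (mat_adjoint X * X) z"
  shows "0 \<le> Re z" "Im z = 0"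
proof -
  note M = adjoint_mult_carrier[of X]
  obtain v where v: "v \<in> carrier_vec (dim_col X)" "v \<noteq> 0\<^sub>v (dim_col X)"
    and ev: "(mat_adjoint X * X) *\<^sub>v v = z \<cdot>\<^sub>v v"
    using assms M unfolding eigenvalue_def eigenvector_def by auto
  have X: "X \<in> carrier_mat (dim_row X) (dim_col X)" by simp
  have Xv: "X *\<^sub>v v \<in> carrier_vec (dim_row X)" by (rule mult_mat_vec_carrier[OF X v(1)])
  have "z * (v \<bullet>c v) = (z \<cdot>\<^sub>v v) \<bullet>c v"
    using v by simp
  also have "\<dots> = (X *\<^sub>v v) \<bullet>c (X *\<^sub>v v)"
    using adjoint_cscalar_prod[OF v(1) Xv] ev
    by (simp add: assoc_mult_mat_vec[OF mat_adjoint_carrier X v(1)])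
  finally have eq: "z * (v \<bullet>c v) = (X *\<^sub>v v) \<bullet>c (X *\<^sub>v v)" .
  have pos: "v \<bullet>c v > 0"
    using v conjugate_square_greater_0_vec[OF v(1)] by simp
  moreover have "(X *\<^sub>v v) \<bullet>c (X *\<^sub>v v) \<ge> 0"
    by (rule conjugate_square_ge_0_vec)
  moreover have z: "z = (X *\<^sub>v v) \<bullet>c (X *\<^sub>v v) / (v \<bullet>c v)"
    using eq pos by (metis less_irrefl nonzero_mult_div_cancel_right)
  ultimately have "Im (v \<bullet>c v) = 0" "Re (v \<bullet>c v) > 0"
    and "Im ((X *\<^sub>v v) \<bullet>c (X *\<^sub>v v)) = 0" "Re ((X *\<^sub>v v) \<bullet>c (X *\<^sub>v v)) \<ge> 0"
    by (auto simp: less_complex_def less_eq_complex_def)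
  then show "0 \<le> Re z" "Im z = 0"
    unfolding z by (simp_all add: Re_divide Im_divide)
qed

lemma mset_singular_values_squared:
  "image_mset (\<lambda>s. of_real (s\<^sup>2)) (mset (singular_values X)) = proots (char_poly (mat_adjoint X * X))"
proof -
  let ?p = "char_poly (mat_adjoint X * X)"
  have p: "?p \<noteq> 0"
    using degree_monic_char_poly[OF adjoint_mult_carrier[of X]] by auto
  have "of_real ((sqrt (Re z))\<^sup>2) = z" if "z \<in># proots ?p" for z
    using that p eigenvalue_adjoint_mult[of X z]
    by (simp add: eigenvalue_root_char_poly[OF adjoint_mult_carrier] complex_eq_iff)
  then have "image_mset (\<lambda>z. of_real ((sqrt (Re z))\<^sup>2)) (proots ?p) = image_mset id (proots ?p)"
    by (intro image_mset_cong) simp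
  then show ?thesis
    by (simp add: singular_values_def multiset.map_comp comp_def)
qed

end

theory Submission
  imports Defs
begin

text \<open>
  Write \<open>A e\<^sub>k = a\<^bsub>p k\<^esub> e\<^bsub>p k\<^esub>\<close> and \<open>B e\<^sub>l = b\<^bsub>q l\<^esub> e\<^bsub>q l\<^esub>\<close> with derangements \<open>p\<close>, \<open>q\<close>, and let \<open>S\<close> be
  the sum of all \<open>|a\<^sub>i|\<^sup>2\<close> and \<open>|b\<^sub>j|\<^sup>2\<close>. Already the largest singular value satisfies
  \<open>\<sigma>\<^sub>1\<^sup>2 \<le> 5 S / 4\<close>, and \<open>S = 1 / d \<le> 1 / 5\<close>. Indeed, expanding \<open>|X v|\<^sup>2\<close> and splitting the cross terms
  by AM-GM bounds it by the sum of \<open>|v\<^sub>k\<^sub>l|\<^sup>2 (|a\<^bsub>p k\<^esub>|\<^sup>2 + |b\<^bsub>q l\<^esub>|\<^sup>2 + |a\<^bsub>p k\<^esub> b\<^sub>l| + |a\<^sub>k b\<^bsub>q l\<^esub>|)\<close>. Since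
  \<open>|a\<^bsub>p k\<^esub> b\<^sub>l| \<le> |a\<^bsub>p k\<^esub>|\<^sup>2 / 4 + |b\<^sub>l|\<^sup>2\<close> and \<open>|a\<^sub>k b\<^bsub>q l\<^esub>| \<le> |a\<^sub>k|\<^sup>2 + |b\<^bsub>q l\<^esub>|\<^sup>2 / 4\<close>, and since \<open>k \<noteq> p k\<close> and
  \<open>l \<noteq> q l\<close>, each bracket is at most \<open>5 S / 4\<close>.
\<close>

section \<open>Bounding singular values by the norm of \<open>X *\<^sub>v v\<close>\<close>

lemma cscalar_prod_self:
  fixes v :: "complex vec"
  shows "v \<bullet>c v = of_real (\<Sum>i<dim_vec v. (cmod (v $ i))\<^sup>2)"
  by (simp add: scalar_prod_def complex_norm_square atLeast0LessThan del: of_real_power)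

text \<open>The number \<open>s\<^sup>2\<close> is an eigenvalue of
  \<open>mat_adjoint X * X\<close>. For an eigenvector \<open>v\<close>, moving the adjoint across
  the inner product gives |X v|^2 = s^2 |v|^2, so a bound on the squared operator norm bounds every
  singular value.\<close>

lemma singular_value_sq_le:
  fixes X :: "complex mat"
  assumes bound: "\<And>v. v \<in> carrier_vec (dim_col X) \<Longrightarrow>
      (\<Sum>i<dim_row X. (cmod ((X *\<^sub>v v) $ i))\<^sup>2) \<le> c * (\<Sum>i<dim_col X. (cmod (v $ i))\<^sup>2)"
    and s: "s \<in> set (singular_values X)"
  shows "s\<^sup>2 \<le> c"
proof -
  let ?p = "char_poly (mat_adjoint X * X)"
  have p: "?p \<noteq> 0"
    using degree_monic_char_poly[OF adjoint_mult_carrier[of X]] by auto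
  have "of_real (s\<^sup>2) \<in># image_mset (\<lambda>s. complex_of_real (s\<^sup>2)) (mset (singular_values X))"
    using s by auto
  then have "complex_of_real (s\<^sup>2) \<in># proots ?p"
    by (simp only: mset_singular_values_squared)
  then have "eigenvalue (mat_adjoint X * X) (of_real (s\<^sup>2))"
    using p by (simp add: eigenvalue_root_char_poly[OF adjoint_mult_carrier])
  then obtain v where v: "v \<in> carrier_vec (dim_col X)" "v \<noteq> 0\<^sub>v (dim_col X)"
    and ev: "(mat_adjoint X * X) *\<^sub>v v = of_real (s\<^sup>2) \<cdot>\<^sub>v v"
    using adjoint_mult_carrier[of X] unfolding eigenvalue_def eigenvector_def by auto
  have X: "X \<in> carrier_mat (dim_row X) (dim_col X)" by simp
  have Xv: "X *\<^sub>v v \<in> carrier_vec (dim_row X)" by (rule mult_mat_vec_carrier[OF X v(1)])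
  have "of_real (s\<^sup>2) * (v \<bullet>c v) = (of_real (s\<^sup>2) \<cdot>\<^sub>v v) \<bullet>c v"
    using v by simp
  also have "\<dots> = (X *\<^sub>v v) \<bullet>c (X *\<^sub>v v)"
    using adjoint_cscalar_prod[OF v(1) Xv] ev
    by (simp add: assoc_mult_mat_vec[OF mat_adjoint_carrier X v(1)])
  finally have "complex_of_real (s\<^sup>2 * (\<Sum>i<dim_col X. (cmod (v $ i))\<^sup>2)) =
      of_real (\<Sum>i<dim_row X. (cmod ((X *\<^sub>v v) $ i))\<^sup>2)"
    unfolding cscalar_prod_self of_real_mult carrier_vecD[OF v(1)] carrier_vecD[OF Xv] .
  then have "s\<^sup>2 * (\<Sum>i<dim_col X. (cmod (v $ i))\<^sup>2) = (\<Sum>i<dim_row X. (cmod ((X *\<^sub>v v) $ i))\<^sup>2)"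
    by (simp only: of_real_eq_iff)
  also have "\<dots> \<le> c * (\<Sum>i<dim_col X. (cmod (v $ i))\<^sup>2)"
    by (rule bound[OF v(1)])
  finally have "s\<^sup>2 * (\<Sum>i<dim_col X. (cmod (v $ i))\<^sup>2) \<le> c * (\<Sum>i<dim_col X. (cmod (v $ i))\<^sup>2)" .
  moreover have "v \<bullet>c v > 0"
    using v conjugate_square_greater_0_vec[OF v(1)] by simp
  then have "(\<Sum>i<dim_col X. (cmod (v $ i))\<^sup>2) > 0"
    using v(1) by (simp add: cscalar_prod_self less_complex_def)
  ultimately show ?thesis
    by simp
qed

section \<open>Kronecker sums and monomial matrices acting on vectors\<close>

lemma sum_lessThan_mult:
  fixes f :: "nat \<Rightarrow> 'a :: comm_monoid_add"
  shows "(\<Sum>r<m * n. f r) = (\<Sum>i<m. \<Sum>j<n. f (i * n + j))"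
proof -
  have "(\<Sum>r<m * n. f r) = (\<Sum>i<m. sum f {i * n..<i * n + n})"
    by (rule sum.nat_group[symmetric])
  also have "\<dots> = (\<Sum>i<m. \<Sum>j<n. f (i * n + j))"
    using sum.shift_bounds_nat_ivl[of f 0 "_ * n" n]
    by (simp add: add.commute atLeast0LessThan)
  finally show ?thesis .
qed

lemma index_pair_less:
  fixes i j m n :: nat
  assumes "i < m" "j < n"
  shows "i * n + j < m * n"
proof -
  have "i * n + j < Suc i * n" using assms by simp
  also have "\<dots> \<le> m * n" using assms by (intro mult_le_mono1) simp
  finally show ?thesis .
qed

text \<open>Read \<open>v\<close> as an m by n array with entry \<open>v $ (k * n + l)\<close> at
  position (k, l): \<open>A\<close> acts on the first index and \<open>B\<close> on the second,
  since each identity factor contributes a Kronecker delta.\<close>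

lemma kronecker_sum_mult_vec:
  fixes A B :: "'a :: comm_ring_1 mat"
  assumes A: "A \<in> carrier_mat m m" and B: "B \<in> carrier_mat n n" and v: "v \<in> carrier_vec (m * n)"
    and i: "i < m" and j: "j < n"
  shows "((A \<otimes>\<^sub>K 1\<^sub>m n + 1\<^sub>m m \<otimes>\<^sub>K B) *\<^sub>v v) $ (i * n + j) =
    (\<Sum>k<m. A $$ (i, k) * v $ (k * n + j)) + (\<Sum>l<n. B $$ (j, l) * v $ (i * n + l))"
proof -
  let ?X = "A \<otimes>\<^sub>K 1\<^sub>m n + 1\<^sub>m m \<otimes>\<^sub>K B"
  have dims: "dim_row ?X = m * n" "dim_col ?X = m * n"
    using A B by (auto simp: kronecker_def)
  have entry: "?X $$ (i * n + j, k * n + l) =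
      (if j = l then A $$ (i, k) else 0) + (if i = k then B $$ (j, l) else 0)"
    if "k < m" "l < n" for k l
    using that A B i j index_pair_less[of i m j n] index_pair_less[of k m l n]
    by (auto simp: kronecker_def)
  have "(?X *\<^sub>v v) $ (i * n + j) = (\<Sum>c<m * n. ?X $$ (i * n + j, c) * v $ c)"
    using v dims index_pair_less[OF i j] by (simp add: scalar_prod_def atLeast0LessThan)
  also have "\<dots> = (\<Sum>k<m. \<Sum>l<n. ((if j = l then A $$ (i, k) else 0)
      + (if i = k then B $$ (j, l) else 0)) * v $ (k * n + l))"
    unfolding sum_lessThan_mult by (intro sum.cong refl) (simp add: entry)
  also have "\<dots> = (\<Sum>k<m. \<Sum>l<n. if j = l then A $$ (i, k) * v $ (k * n + l) else 0)
      + (\<Sum>k<m. \<Sum>l<n. if i = k then B $$ (j, l) * v $ (k * n + l) else 0)"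
    unfolding sum.distrib[symmetric] by (intro sum.cong refl) (simp add: distrib_right)
  also have "(\<Sum>k<m. \<Sum>l<n. if i = k then B $$ (j, l) * v $ (k * n + l) else 0)
      = (\<Sum>l<n. \<Sum>k<m. if i = k then B $$ (j, l) * v $ (k * n + l) else 0)"
    by (rule sum.swap)
  also have "(\<Sum>k<m. \<Sum>l<n. if j = l then A $$ (i, k) * v $ (k * n + l) else 0) + \<dots>
      = (\<Sum>k<m. A $$ (i, k) * v $ (k * n + j)) + (\<Sum>l<n. B $$ (j, l) * v $ (i * n + l))"
    using i j by simp
  finally show ?thesis .
qed

text \<open>Row \<open>i\<close> of the product vanishes outside column
  \<open>inv_into UNIV p i\<close>, where its entry is \<open>c i\<close>; hence a sum along the row
  collapses to one term.\<close>

lemma diag_mult_permutation: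
  fixes c :: "nat \<Rightarrow> 'a :: comm_ring_1"
  assumes "permutation_mat n P"
  obtains p where "p permutes {..<n}" "mat_diag n c * P \<in> carrier_mat n n"
    "\<And>i j. i < n \<Longrightarrow> j < n \<Longrightarrow> P $$ (i, j) = (if i = p j then 1 else 0)"
    "\<And>i f. i < n \<Longrightarrow> (\<Sum>j<n. (mat_diag n c * P) $$ (i, j) * f j) = c i * f (inv_into UNIV p i)"
proof -
  obtain p where p: "p permutes {..<n}" and P: "P = Matrix.mat n n (\<lambda>(i, j). if i = p j then 1 else 0)"
    using assms unfolding permutation_mat_def by blast
  have PC: "P \<in> carrier_mat n n" by (simp add: P)
  have entry: "(mat_diag n c * P) $$ (i, j) = (if inv_into UNIV p i = j then c i else 0)"
    if "i < n" "j < n" for i j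
    using that unfolding mat_diag_mult_left[OF PC] by (auto simp: P permutes_inverses[OF p])
  have "(\<Sum>j<n. (mat_diag n c * P) $$ (i, j) * f j) = c i * f (inv_into UNIV p i)" if "i < n" for i f
  proof -
    have "inv_into UNIV p i < n"
      using permutes_in_image[OF permutes_inv[OF p], of i] that by simp
    have "(\<Sum>j<n. (mat_diag n c * P) $$ (i, j) * f j) =
        (\<Sum>j<n. if inv_into UNIV p i = j then c i * f j else 0)"
      using that by (intro sum.cong refl) (simp add: entry)
    with \<open>inv_into UNIV p i < n\<close> show ?thesis by simp
  qed
  moreover have "P $$ (i, j) = (if i = p j then 1 else 0)" if "i < n" "j < n" for i j
    using that by (simp add: P)
  moreover have "mat_diag n c * P \<in> carrier_mat n n"
    using PC by (rule mult_carrier_mat[OF mat_diag_dim])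
  ultimately show ?thesis
    by (intro that[OF p])
qed

section \<open>The norm estimate with constant 5/4\<close>

lemma norm_add_squared_le:
  fixes \<alpha> \<beta> u w :: complex
  shows "(cmod (\<alpha> * u + \<beta> * w))\<^sup>2 \<le>
    ((cmod \<alpha>)\<^sup>2 + cmod \<alpha> * cmod \<beta>) * (cmod u)\<^sup>2 + ((cmod \<beta>)\<^sup>2 + cmod \<alpha> * cmod \<beta>) * (cmod w)\<^sup>2"
proof -
  have "(cmod (\<alpha> * u + \<beta> * w))\<^sup>2 \<le> (cmod \<alpha> * cmod u + cmod \<beta> * cmod w)\<^sup>2"
    by (intro power_mono norm_triangle_le) (simp_all add: norm_mult)
  \<comment> \<open>AM-GM on the cross term, written with its exact deficit, leaves one weight on
    \<open>u\<close> and one on \<open>w\<close>, which can be summed separately.\<close>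
  also have "\<dots> = ((cmod \<alpha>)\<^sup>2 + cmod \<alpha> * cmod \<beta>) * (cmod u)\<^sup>2
      + ((cmod \<beta>)\<^sup>2 + cmod \<alpha> * cmod \<beta>) * (cmod w)\<^sup>2 - (cmod \<alpha> * cmod \<beta>) * (cmod u - cmod w)\<^sup>2"
    by (simp add: power2_eq_square algebra_simps)
  also have "\<dots> \<le> ((cmod \<alpha>)\<^sup>2 + cmod \<alpha> * cmod \<beta>) * (cmod u)\<^sup>2
      + ((cmod \<beta>)\<^sup>2 + cmod \<alpha> * cmod \<beta>) * (cmod w)\<^sup>2"
    by simp
  finally show ?thesis .
qed

text \<open>The weights are unequal on purpose: in the bracket to be bounded,
  \<open>x\<^sup>2\<close> already occurs with coefficient 1 and can take only 1/4 more, while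
  \<open>y\<^sup>2\<close> is new and can take 1.\<close>

lemma mult_le_square_quarter_square:
  fixes x y :: real
  shows "x * y \<le> x\<^sup>2 / 4 + y\<^sup>2"
  using zero_le_power2[of "x / 2 - y"] by (simp add: power2_eq_square algebra_simps)

lemma two_le_sum_lessThan:
  fixes f :: "nat \<Rightarrow> real"
  assumes "\<And>i. f i \<ge> 0" "i < n" "j < n" "i \<noteq> j"
  shows "f i + f j \<le> (\<Sum>i<n. f i)"
  using sum_mono2[of "{..<n}" "{i, j}" f] assms by simp

lemma monomial_kronecker_sum_norm_bound:
  fixes a b :: "nat \<Rightarrow> complex" and v :: "nat \<Rightarrow> nat \<Rightarrow> complex"
  assumes p: "p permutes {..<d}" and q: "q permutes {..<d}"
    and pd: "\<And>i. i < d \<Longrightarrow> p i \<noteq> i" and qd: "\<And>i. i < d \<Longrightarrow> q i \<noteq> i"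
  shows "(\<Sum>i<d. \<Sum>j<d. (cmod (a i * v (inv_into UNIV p i) j + b j * v i (inv_into UNIV q j)))\<^sup>2)
    \<le> 5 / 4 * (\<Sum>i<d. (cmod (a i))\<^sup>2 + (cmod (b i))\<^sup>2) * (\<Sum>i<d. \<Sum>j<d. (cmod (v i j))\<^sup>2)"
proof -
  let ?S = "\<Sum>i<d. (cmod (a i))\<^sup>2 + (cmod (b i))\<^sup>2"
  have bracket: "(cmod (a (p k)))\<^sup>2 + cmod (a (p k)) * cmod (b l)
      + ((cmod (b (q l)))\<^sup>2 + cmod (a k) * cmod (b (q l))) \<le> 5 / 4 * ?S" if "k < d" "l < d" for k l
  proof -
    have "p k < d" "q l < d"
      using that permutes_in_image[OF p] permutes_in_image[OF q] by auto
    then have "(cmod (a k))\<^sup>2 + (cmod (a (p k)))\<^sup>2 \<le> (\<Sum>i<d. (cmod (a i))\<^sup>2)"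
      and "(cmod (b l))\<^sup>2 + (cmod (b (q l)))\<^sup>2 \<le> (\<Sum>i<d. (cmod (b i))\<^sup>2)"
      using that pd[of k] qd[of l]
      by (auto intro!: two_le_sum_lessThan[where f = "\<lambda>i. (cmod (_ i))\<^sup>2"])
    moreover have "cmod (a k) * cmod (b (q l)) \<le> (cmod (b (q l)))\<^sup>2 / 4 + (cmod (a k))\<^sup>2"
      using mult_le_square_quarter_square[of "cmod (b (q l))" "cmod (a k)"] by (simp only: mult.commute)
    \<comment> \<open>The squares at \<open>p k\<close> and \<open>q l\<close> now have coefficient
      5/4, those of \<open>a k\<close> and \<open>b l\<close> only 1; nonnegativity raises the
      latter to 5/4.\<close>
    moreover note mult_le_square_quarter_square[of "cmod (a (p k))" "cmod (b l)"]
      zero_le_power2[of "cmod (a k)"] zero_le_power2[of "cmod (b l)"]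
    ultimately show ?thesis
      unfolding sum.distrib distrib_left by linarith
  qed
  have "(\<Sum>i<d. \<Sum>j<d. (cmod (a i * v (inv_into UNIV p i) j + b j * v i (inv_into UNIV q j)))\<^sup>2)
    \<le> (\<Sum>i<d. \<Sum>j<d. ((cmod (a i))\<^sup>2 + cmod (a i) * cmod (b j)) * (cmod (v (inv_into UNIV p i) j))\<^sup>2
        + ((cmod (b j))\<^sup>2 + cmod (a i) * cmod (b j)) * (cmod (v i (inv_into UNIV q j)))\<^sup>2)"
    by (intro sum_mono norm_add_squared_le)
  also have "\<dots> =
      (\<Sum>i<d. \<Sum>j<d. ((cmod (a i))\<^sup>2 + cmod (a i) * cmod (b j)) * (cmod (v (inv_into UNIV p i) j))\<^sup>2)
      + (\<Sum>i<d. \<Sum>j<d. ((cmod (b j))\<^sup>2 + cmod (a i) * cmod (b j)) * (cmod (v i (inv_into UNIV q j)))\<^sup>2)"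
    by (simp only: sum.distrib)
  \<comment> \<open>Substituting \<open>i = p k\<close> here and \<open>j = q l\<close> in the other
    sum puts both weights on the same entry \<open>v k l\<close>, so they add up to the
    bracket.\<close>
  also have "(\<Sum>i<d. \<Sum>j<d. ((cmod (a i))\<^sup>2 + cmod (a i) * cmod (b j)) * (cmod (v (inv_into UNIV p i) j))\<^sup>2)
      = (\<Sum>k<d. \<Sum>j<d. ((cmod (a (p k)))\<^sup>2 + cmod (a (p k)) * cmod (b j)) * (cmod (v k j))\<^sup>2)"
    by (subst sum.permute[OF p]) (simp add: permutes_inverses[OF p])
  also have "(\<Sum>i<d. \<Sum>j<d. ((cmod (b j))\<^sup>2 + cmod (a i) * cmod (b j)) * (cmod (v i (inv_into UNIV q j)))\<^sup>2)
      = (\<Sum>i<d. \<Sum>l<d. ((cmod (b (q l)))\<^sup>2 + cmod (a i) * cmod (b (q l))) * (cmod (v i l))\<^sup>2)"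
    by (rule sum.cong[OF refl], subst sum.permute[OF q]) (simp add: permutes_inverses[OF q])
  also have "(\<Sum>k<d. \<Sum>l<d. ((cmod (a (p k)))\<^sup>2 + cmod (a (p k)) * cmod (b l)) * (cmod (v k l))\<^sup>2)
      + (\<Sum>k<d. \<Sum>l<d. ((cmod (b (q l)))\<^sup>2 + cmod (a k) * cmod (b (q l))) * (cmod (v k l))\<^sup>2)
      = (\<Sum>k<d. \<Sum>l<d. ((cmod (a (p k)))\<^sup>2 + cmod (a (p k)) * cmod (b l)
          + ((cmod (b (q l)))\<^sup>2 + cmod (a k) * cmod (b (q l)))) * (cmod (v k l))\<^sup>2)"
    by (simp only: sum.distrib[symmetric] distrib_right[symmetric])
  also have "\<dots> \<le> (\<Sum>k<d. \<Sum>l<d. 5 / 4 * ?S * (cmod (v k l))\<^sup>2)"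
    by (intro sum_mono mult_right_mono bracket) auto
  also have "\<dots> = 5 / 4 * ?S * (\<Sum>k<d. \<Sum>l<d. (cmod (v k l))\<^sup>2)"
    by (simp only: sum_distrib_left)
  finally show ?thesis .
qed

section \<open>From the norm bound to the two largest singular values\<close>

theorem lemma9:
  fixes d :: nat
    and a b :: "nat \<Rightarrow> complex"
    and P\<^sub>A P\<^sub>B A B X :: "complex mat"
  assumes "d \<ge> 5"
    and "permutation_mat d P\<^sub>A" and "permutation_mat d P\<^sub>B"
    and "\<forall>i<d. P\<^sub>A $$ (i, i) = 0" and "\<forall>i<d. P\<^sub>B $$ (i, i) = 0"
    and "A = mat_diag d a * P\<^sub>A" and "B = mat_diag d b * P\<^sub>B"
    and "(\<Sum>i<d. (cmod (a i))\<^sup>2 + (cmod (b i))\<^sup>2) = 1 / real d"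
    and "X = A \<otimes>\<^sub>K 1\<^sub>m d + 1\<^sub>m d \<otimes>\<^sub>K B"
  shows "(singular_values X ! 0)\<^sup>2 + (singular_values X ! 1)\<^sup>2 \<le> 1 / 2"
proof -
  obtain p where p: "p permutes {..<d}" and A: "A \<in> carrier_mat d d"
    and PA: "\<And>i j. i < d \<Longrightarrow> j < d \<Longrightarrow> P\<^sub>A $$ (i, j) = (if i = p j then 1 else 0)"
    and sum_A: "\<And>i f. i < d \<Longrightarrow> (\<Sum>j<d. A $$ (i, j) * f j) = a i * f (inv_into UNIV p i)"
    by (rule diag_mult_permutation[OF assms(2), of a, folded assms(6)]) (rule that)
  obtain q where q: "q permutes {..<d}" and B: "B \<in> carrier_mat d d"
    and PB: "\<And>i j. i < d \<Longrightarrow> j < d \<Longrightarrow> P\<^sub>B $$ (i, j) = (if i = q j then 1 else 0)"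
    and sum_B: "\<And>i f. i < d \<Longrightarrow> (\<Sum>j<d. B $$ (i, j) * f j) = b i * f (inv_into UNIV q i)"
    by (rule diag_mult_permutation[OF assms(3), of b, folded assms(7)]) (rule that)
  \<comment> \<open>A fixed point would put a 1 on the diagonal.\<close>
  have pd: "p i \<noteq> i" and qd: "q i \<noteq> i" if "i < d" for i
    using that PA[of i i] PB[of i i] assms(4,5) by (auto split: if_splits)
  have dims: "dim_row X = d * d" "dim_col X = d * d"
    using A B by (auto simp: assms(9) kronecker_def)
  have sv: "s\<^sup>2 \<le> 1 / 4" if "s \<in> set (singular_values X)" for s
  proof (rule singular_value_sq_le[OF _ that])
    fix v :: "complex vec"
    assume "v \<in> carrier_vec (dim_col X)"
    then have v: "v \<in> carrier_vec (d * d)" by (simp add: dims)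
    have "(\<Sum>r<dim_row X. (cmod ((X *\<^sub>v v) $ r))\<^sup>2)
        = (\<Sum>i<d. \<Sum>j<d. (cmod (a i * v $ (inv_into UNIV p i * d + j)
          + b j * v $ (i * d + inv_into UNIV q j)))\<^sup>2)"
      unfolding dims sum_lessThan_mult
      by (intro sum.cong refl) (simp add: assms(9) kronecker_sum_mult_vec[OF A B v] sum_A sum_B)
    also have "\<dots> \<le> 5 / 4 * (1 / real d) * (\<Sum>i<d. \<Sum>j<d. (cmod (v $ (i * d + j)))\<^sup>2)"
      using monomial_kronecker_sum_norm_bound[OF p q pd qd, where v = "\<lambda>i j. v $ (i * d + j)"]
      unfolding assms(8)[symmetric] by blast
    \<comment> \<open>This is where \<open>d \<ge> 5\<close> enters: 5/(4 d) is at most 1/4.\<close>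
    also have "\<dots> \<le> 1 / 4 * (\<Sum>i<d. \<Sum>j<d. (cmod (v $ (i * d + j)))\<^sup>2)"
      using assms(1) by (intro mult_right_mono sum_nonneg) (auto simp: field_simps)
    finally show "(\<Sum>r<dim_row X. (cmod ((X *\<^sub>v v) $ r))\<^sup>2)
        \<le> 1 / 4 * (\<Sum>r<dim_col X. (cmod (v $ r))\<^sup>2)"
      by (simp only: dims sum_lessThan_mult)
  qed
  \<comment> \<open>The list has \<open>d * d\<close> entries, at least 25, so positions 0 and 1
    exist and hold actual singular values.\<close>
  have "5 * 5 \<le> d * d"
    using assms(1) by (intro mult_le_mono)
  then have "{singular_values X ! 0, singular_values X ! 1} \<subseteq> set (singular_values X)"
    using assms(1) by (simp add: length_singular_values dims)
  then show ?thesis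
    using sv[of "singular_values X ! 0"] sv[of "singular_values X ! 1"] by simp
qed

end
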